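(* Let $n\ge 2$, let $B_n$ be the closed unit Euclidean ball in $\mathbb{R}^n$ centered at the origin, and let $k(n)$ be the integer defined in the context. Suppose that Property $\mathcal{H}(n,m)$, defined in the context, holds for $m=k(n)$. Then $$\theta_n(B_n)=\|P'\|_{B_n},$$ where $\theta_n(B_n)$ is the minimal norm $\|P\|_{B_n}$ of an interpolation projector $P:C(B_n)\to\Pi_1(\mathbb{R}^n)$ with nodes in $B_n$, and $P'$ is an interpolation projector whose nodes coincide with the vertices of a regular simplex inscribed into $B_n$.
   Context: $C(B_n)$ is the space of continuous functions $f:B_n\to\mathbb{R}$ with norm $\|f\|_{C(B_n)}=\max_{x\in B_n}|f(x)|$. $\Pi_1(\mathbb{R}^n)$ is the set of polynomials in $n$ variables of degree $\le 1$. The interpolation projector $P:C(B_n)\to\Pi_1(\mathbb{R}^n)$ with nodes $x^{(1)},\dots,x^{(n+1)}\in B_n$ (the vertices of a nondegenerate $n$-dimensional simplex) is defined by $Pf(x^{(j)})=f(x^{(j)})$, $j=1,\dots,n+1$. $\|P\|_{B_n}$ denotes the norm of $P$ as an operator from $C(B_n)$ to $C(B_n)$. A simplex is inscribed into $B_n$ if all its vertices lie on the boundary sphere. The norm $\|P'\|_{B_n}$ does not depend on the choice of the regular simplex inscribed into $B_n$. Definition of $k(n)$: put $$\psi(t):=\frac{2\sqrt n}{n+1}\bigl(t(n+1-t)\bigr)^{1/2}+\left|1-\frac{2t}{n+1}\right|,\quad 0\le t\le n+1,\qquad a:=\left\lfloor \frac{n+1}{2}-\frac{\sqrt{n+1}}{2}\right\rfloor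 ,$$ and let $k(n):=a+1$ if $\psi(a+1)\ge\psi(a)$, and $k(n):=a$ if $\psi(a+1)<\psi(a)$. For all $n\ge2$ one has $1\le k(n)\le \frac n2$. Property $\mathcal{H}(n,m)$, for a natural number $m\le \frac n2$. Let $S\subset\mathbb{R}^n$ be a nondegenerate simplex and let $E$ be its minimal ellipsoid, i.e. the unique ellipsoid of minimum volume containing $S$. To each set of $m$ vertices of $S$ assign a point $y\in E$ as follows: let $g$ be the center of gravity (arithmetic mean of vertices) of the $(m-1)$-dimensional face of $S$ containing the selected vertices, let $h$ be the center of gravity of the $(n-m)$-dimensional face containing the remaining $n+1-m$ vertices; then $y$ is the intersection point of the straight line $(gh)$ with the boundary of $E$ in the direction from $g$ to $h$ (i.e. the point $g+t(h-g)$, $t>0$, on the boundary of $E$). Property $\mathcal{H}(n,m)$ states: for any nondegenerate simplex $S\subset B_n$ there exists a set of $m$ vertices of $S$ such that the corresponding point $y$ belongs to $B_n$. *)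

theory Defs
  imports "HOL-Analysis.Analysis"
begin

text \<open>A function on \<open>\<Omega>\<close> is represented by a total function of which only the values on \<open>\<Omega>\<close>
  matter; the space \<open>C(\<Omega>)\<close> then consists of the \<open>f\<close> with \<open>continuous_on \<Omega> f\<close>.  All sets \<open>\<Omega>\<close>
  considered are nonempty and compact, so the suprema below are suprema of nonempty bounded sets.\<close>

definition unif_norm :: "(real ^ 'n) set \<Rightarrow> (real ^ 'n \<Rightarrow> real) \<Rightarrow> real" where
  "unif_norm \<Omega> f = (SUP x\<in>\<Omega>. \<bar>f x\<bar>)"

definition operator_norm ::
    "(real ^ 'n) set \<Rightarrow> ((real ^ 'n \<Rightarrow> real) \<Rightarrow> (real ^ 'n \<Rightarrow> real)) \<Rightarrow> real" where
  "operator_norm \<Omega> P = (SUP f\<in>{f. continuous_on \<Omega> f \<and> unif_norm \<Omega> f \<le> 1}. unif_norm \<Omega> (P f))"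

definition linear_polynomials :: "(real ^ 'n \<Rightarrow> real) set" where
  "linear_polynomials = {p. \<exists>c a. \<forall>x. p x = c + (\<Sum>i\<in>UNIV. a i * x $ i)}"

definition simplex_vertices :: "(real ^ 'n) set \<Rightarrow> bool" where
  "simplex_vertices X \<longleftrightarrow> card X = CARD('n) + 1 \<and> \<not> affine_dependent X"

definition interpolation_projector ::
    "(real ^ 'n) set \<Rightarrow> (real ^ 'n) set \<Rightarrow> ((real ^ 'n \<Rightarrow> real) \<Rightarrow> (real ^ 'n \<Rightarrow> real)) \<Rightarrow> bool" where
  "interpolation_projector \<Omega> X P \<longleftrightarrow>
     simplex_vertices X \<and> X \<subseteq> \<Omega> \<and>
     (\<forall>f. continuous_on \<Omega> f \<longrightarrow> P f \<in> linear_polynomials \<and> (\<forall>x\<in>X. P f x = f x))"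

definition theta :: "(real ^ 'n) set \<Rightarrow> real" where
  "theta \<Omega> = Inf {operator_norm \<Omega> P | P X. interpolation_projector \<Omega> X P}"

abbreviation unit_ball :: "(real ^ 'n) set" where
  "unit_ball \<equiv> cball 0 1"

definition regular_inscribed :: "(real ^ 'n) set \<Rightarrow> bool" where
  "regular_inscribed X \<longleftrightarrow>
     simplex_vertices X \<and> X \<subseteq> sphere 0 1 \<and>
     (\<exists>d. \<forall>x\<in>X. \<forall>y\<in>X. x \<noteq> y \<longrightarrow> dist x y = d)"

definition psi :: "nat \<Rightarrow> real \<Rightarrow> real" where
  "psi n t = 2 * sqrt (real n) / (real n + 1) * sqrt (t * (real n + 1 - t))
             + \<bar>1 - 2 * t / (real n + 1)\<bar>"

text \<open>The floor is nonnegative, so the truncation by \<open>nat\<close> is harmless.\<close>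

definition a_index :: "nat \<Rightarrow> nat" where
  "a_index n = nat \<lfloor>(real n + 1) / 2 - sqrt (real n + 1) / 2\<rfloor>"

definition k_index :: "nat \<Rightarrow> nat" where
  "k_index n = (if psi n (real (a_index n + 1)) \<ge> psi n (real (a_index n))
                then a_index n + 1 else a_index n)"

definition ellipsoid :: "(real ^ 'n) set \<Rightarrow> bool" where
  "ellipsoid E \<longleftrightarrow>
     (\<exists>(A :: real ^ 'n ^ 'n) c. invertible A \<and> E = (\<lambda>x. c + A *v x) ` cball 0 1)"

definition minimal_ellipsoid :: "(real ^ 'n) set \<Rightarrow> (real ^ 'n) set \<Rightarrow> bool" where
  "minimal_ellipsoid S E \<longleftrightarrow>
     ellipsoid E \<and> S \<subseteq> E \<and>
     (\<forall>E'. ellipsoid E' \<and> S \<subseteq> E' \<longrightarrow> measure lebesgue E \<le> measure lebesgue E')"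

definition centroid :: "(real ^ 'n) set \<Rightarrow> real ^ 'n" where
  "centroid A = (1 / real (card A)) *\<^sub>R (\<Sum>x\<in>A. x)"

text \<open>The point \<open>y\<close> assigned to the set \<open>M\<close> of vertices.  It is unique: the centroid \<open>g\<close> lies in
  \<open>E\<close>, possibly on its boundary (when \<open>M\<close> is a singleton), which is why \<open>t > 0\<close> is strict.\<close>

definition assigned_point ::
    "(real ^ 'n) set \<Rightarrow> (real ^ 'n) set \<Rightarrow> (real ^ 'n) set \<Rightarrow> real ^ 'n \<Rightarrow> bool" where
  "assigned_point X E M y \<longleftrightarrow>
     y \<in> frontier E \<and>
     (\<exists>t>0. y = centroid M + t *\<^sub>R (centroid (X - M) - centroid M))"

text \<open>Meaningful for \<open>1 \<le> m \<le> n / 2\<close>, where \<open>n = CARD('n)\<close>.  The minimal ellipsoid of a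
  nondegenerate simplex exists and is unique, so quantifying over \<open>E\<close> universally just names it.\<close>

definition property_H :: "'n::finite itself \<Rightarrow> nat \<Rightarrow> bool" where
  "property_H _ m \<longleftrightarrow>
     (\<forall>(X :: (real ^ 'n) set) E.
        simplex_vertices X \<and> convex hull X \<subseteq> unit_ball \<and> minimal_ellipsoid (convex hull X) E \<longrightarrow>
        (\<exists>M y. M \<subseteq> X \<and> card M = m \<and> assigned_point X E M y \<and> y \<in> unit_ball))"

end

theory Submission
  imports Defs
begin

text \<open>Let \<open>n = CARD('n)\<close>, \<open>k = k_index n\<close>, and let \<open>\<lambda>\<^sub>v\<close> be the barycentric coordinates of a simplex with vertex
  set \<open>X\<close>.  The interpolant of \<open>f\<close> is \<open>\<Sum>v\<in>X. \<lambda>\<^sub>v * f v\<close>, so the norm of the projector is the largest value of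
  \<open>\<Sum>v\<in>X. \<bar>\<lambda>\<^sub>v\<bar>\<close> on the ball.  Both halves of the proof show that \<open>psi n k\<close> is the right bound, and both rest on
  one description of ellipsoids: for a regular inscribed simplex, the unit ball is the set where
  \<open>\<Sum>v\<in>X. \<lambda>\<^sub>v\<^sup>2 \<le> 1\<close> (\<open>sum_bary_squares\<close>).  Consequently the minimal ellipsoid of any simplex, which is the affine image
  of this ball, is given by the same inequality.

  For a regular inscribed simplex, the Cauchy--Schwarz inequality bounds \<open>\<Sum>v\<in>X. \<bar>\<lambda>\<^sub>v\<bar>\<close> at a point with \<open>m\<close>
  negative coordinates by \<open>phi n m\<close> (\<open>sum_abs_bary_le_phi\<close>).  The function \<open>phi\<close> is concave, and \<open>k\<close> is chosen
  between the two integers next to its peak, so \<open>phi n m \<le> psi n k\<close> for every integer \<open>m\<close> in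
  question (\<open>phi_le_psi_k_index\<close>).

  For an arbitrary simplex in the ball, the assumed property yields \<open>k\<close> vertices whose assigned point
  \<open>y\<close> lies in the ball.  At \<open>y\<close> the coordinates of the selected vertices are equal, those of the other vertices are
  equal, and all their squares sum to 1.  This determines them, and they are exactly a
  case of equality in the Cauchy--Schwarz estimate: \<open>\<Sum>v\<in>X. \<bar>\<lambda>\<^sub>v\<bar> = phi n k\<close>, which is \<open>psi n k\<close> since
  \<open>k \<le> (n + 1) / 2\<close> (\<open>assigned_point_parameter\<close>, \<open>operator_norm_ge_if_property_H\<close>).

  Applying the property to a simplex requires that its ellipsoid is known to be
  minimal (\<open>minimal_ellipsoid_of_affine_image\<close>).  A competing ellipsoid amounts to an affine map \<open>z \<mapsto> d + D z\<close> that
  sends the vertices of the regular simplex into the unit ball; then \<open>D\<close> has squared Frobenius norm at most \<open>n\<close>, and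
  Hadamard's inequality gives \<open>\<bar>det D\<bar> \<le> 1\<close>.\<close>

section \<open>Determinants and the volume of linear images\<close>

text \<open>Gram--Schmidt without normalization: subtracting from a row its projection onto the span of
  other rows changes no determinant and does not lengthen the row.\<close>

lemma orthogonal_rows_same_det:
  fixes A :: "real ^ 'n ^ 'n"
  assumes "finite S"
  shows "\<exists>B. det B = det A \<and> (\<forall>i. norm (B $ i) \<le> norm (A $ i)) \<and>
             pairwise (\<lambda>i j. B $ i \<bullet> B $ j = 0) S"
  using assms
proof (induction S)
  case empty
  show ?case by (rule exI[of _ A]) auto
next
  case (insert i S)
  then obtain B where B: "det B = det A" "\<And>i. norm (B $ i) \<le> norm (A $ i)"
    "pairwise (\<lambda>i j. B $ i \<bullet> B $ j = 0) S"
    by auto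
  obtain y z where y: "y \<in> span (($) B ` S)"
    and z: "\<And>w. w \<in> span (($) B ` S) \<Longrightarrow> orthogonal z w" and yz: "B $ i = y + z"
    using orthogonal_subspace_decomp_exists by metis
  define C where "C = (\<chi> k. if k = i then row i B + (- y) else row k B)"
  have C: "C $ i = z" "\<And>k. k \<noteq> i \<Longrightarrow> C $ k = B $ k"
    using yz by (simp_all add: C_def row_def vec_eq_iff)
  have "- y \<in> vec.span {row j B |j. j \<noteq> i}"
  proof -
    have "($) B ` S \<subseteq> {row j B |j. j \<noteq> i}"
      using insert.hyps(2) by (force simp: row_def)
    from span_mono[OF this] y show ?thesis
      unfolding span_vec_eq by (auto intro: span_neg)
  qed
  from det_row_span[OF this] have "det C = det A"
    using B(1) by (simp add: C_def)
  moreover have "norm (C $ k) \<le> norm (A $ k)" for k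
  proof (cases "k = i")
    case True
    have "(norm (y + z))\<^sup>2 = (norm y)\<^sup>2 + (norm z)\<^sup>2"
      using z[OF y] by (intro norm_add_Pythagorean) (simp add: orthogonal_commute)
    hence "norm z \<le> norm (B $ i)"
      using power2_le_imp_le[of "norm z" "norm (B $ i)"] by (auto simp: yz)
    thus ?thesis using B(2)[of i] C(1) True by simp
  qed (use B(2) C(2) in auto)
  moreover have "pairwise (\<lambda>i j. C $ i \<bullet> C $ j = 0) (insert i S)"
  proof -
    have "z \<bullet> B $ j = 0" if "j \<in> S" for j
      using z[of "B $ j"] that by (auto simp: orthogonal_def span_base)
    thus ?thesis
      using B(3) insert.hyps(2) C by (simp add: pairwise_def inner_commute) (metis C(2))
  qed
  ultimately show ?case by blast
qed

lemma Hadamard_inequality: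
  fixes A :: "real ^ 'n ^ 'n"
  shows "\<bar>det A\<bar> \<le> (\<Prod>i\<in>UNIV. norm (A $ i))"
proof -
  obtain B where B: "det B = det A" "\<And>i. norm (B $ i) \<le> norm (A $ i)"
    "pairwise (\<lambda>i j. B $ i \<bullet> B $ j = 0) UNIV"
    using orthogonal_rows_same_det[of UNIV A] by auto
  have entry: "(B ** transpose B) $ i $ j = B $ i \<bullet> B $ j" for i j
    by (simp add: matrix_matrix_mult_def transpose_def inner_vec_def)
  have "(det B)\<^sup>2 = det (B ** transpose B)"
    by (simp add: det_mul det_transpose power2_eq_square)
  also have "\<dots> = (\<Prod>i\<in>UNIV. norm (B $ i))\<^sup>2"
    using B(3)
    by (subst det_diagonal) (auto simp: entry pairwise_def prod_power_distrib power2_norm_eq_inner)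
  finally have "\<bar>det B\<bar> = (\<Prod>i\<in>UNIV. norm (B $ i))"
    by (metis abs_of_nonneg norm_ge_zero power2_eq_iff_nonneg prod_nonneg power2_abs abs_ge_zero)
  also have "\<dots> \<le> (\<Prod>i\<in>UNIV. norm (A $ i))"
    by (intro prod_mono) (auto simp: B(2))
  finally show ?thesis using B(1) by simp
qed

text \<open>Hadamard bounds the square of the determinant by the product of the squared row lengths.  The
  mean of these \<open>n\<close> numbers is at most 1, and \<open>x \<le> exp (x - 1)\<close> replaces the inequality between the
  arithmetic and the geometric mean.\<close>

lemma abs_det_le_1_if_Frobenius_norm_le:
  fixes A :: "real ^ 'n ^ 'n"
  assumes "(\<Sum>i\<in>UNIV. (norm (A $ i))\<^sup>2) \<le> CARD('n)"
  shows "\<bar>det A\<bar> \<le> 1"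
proof -
  have "(\<Prod>i\<in>UNIV. norm (A $ i))\<^sup>2 = (\<Prod>i\<in>UNIV. (norm (A $ i))\<^sup>2)"
    by (simp add: prod_power_distrib)
  also have "\<dots> \<le> (\<Prod>i\<in>UNIV. exp ((norm (A $ i))\<^sup>2 - 1))"
    by (intro prod_mono) (use exp_ge_add_one_self in \<open>auto, smt (verit)\<close>)
  also have "\<dots> = exp ((\<Sum>i\<in>UNIV. (norm (A $ i))\<^sup>2) - CARD('n))"
    by (simp add: exp_sum[symmetric] sum_subtractf)
  also have "\<dots> \<le> 1" using assms by simp
  finally have "(\<Prod>i\<in>UNIV. norm (A $ i)) \<le> 1"
    using power2_le_imp_le[of _ 1] by fastforce
  with Hadamard_inequality[of A] show ?thesis by linarith
qed

lemma measure_linear_image_if_unit_det: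
  fixes f :: "real ^ 'n \<Rightarrow> real ^ 'n"
  assumes "linear f" "\<bar>det (matrix f)\<bar> = 1"
    and "\<And>a b. measure lebesgue (f ` cbox a b) = measure lebesgue (cbox a b)"
    and "S \<in> lmeasurable"
  shows "f ` S \<in> lmeasurable \<and> measure lebesgue (f ` S) = \<bar>det (matrix f)\<bar> * measure lebesgue S"
  using measure_linear_sufficient[OF assms(1,4), where m = 1] assms(2,3) by simp

text \<open>Both sides are multiplicative in the map, so elementary maps suffice.  A coordinate swap and
  a shear preserve the volume of boxes and have determinant of modulus 1.\<close>

lemma measure_matrix_image:
  fixes A :: "real ^ 'n ^ 'n"
  assumes "S \<in> lmeasurable"
  shows "measure lebesgue ((*v) A ` S) = \<bar>det A\<bar> * measure lebesgue S"
proof -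
  define Q where "Q f \<longleftrightarrow> (\<forall>S\<in>lmeasurable. f ` S \<in> lmeasurable \<and>
      measure lebesgue (f ` S) = \<bar>det (matrix f)\<bar> * measure lebesgue S)"
    for f :: "real ^ 'n \<Rightarrow> real ^ 'n"
  have "Q ((*v) A)"
  proof (rule induct_linear_elementary[where P = Q])
    show "linear ((*v) A)" by simp
  next
    fix f g :: "real ^ 'n \<Rightarrow> real ^ 'n"
    assume "linear f" "linear g" "Q f" "Q g"
    thus "Q (f \<circ> g)"
      by (simp add: Q_def matrix_compose det_mul abs_mult flip: image_image image_comp)
  next
    fix f :: "real ^ 'n \<Rightarrow> real ^ 'n" and i
    assume f: "linear f" "\<And>x. f x $ i = 0"
    have "\<not> surj f"
      using f(2) by (metis one_neq_zero surjE vec_component)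
    hence inj: "\<not> inj f"
      using f(1) linear_injective_imp_surjective by blast
    hence "negligible (f ` S)" for S
      using f(1) negligible_UNIV negligible_linear_singular_image by blast
    moreover have "det (matrix f) = 0"
      using inj det_nz_iff_inj[OF f(1)] by blast
    ultimately show "Q f"
      by (simp add: Q_def negligible_imp_measurable negligible_imp_measure0)
  next
    fix c :: "'n \<Rightarrow> real"
    have "det (matrix (\<lambda>x. \<chi> i. c i * x $ i)) = prod c UNIV"
      by (subst det_diagonal) (auto simp: matrix_def axis_def)
    thus "Q (\<lambda>x. \<chi> i. c i * x $ i)"
      by (simp add: Q_def measurable_stretch measure_stretch)
  next
    fix m n :: 'n
    assume "m \<noteq> n"
    let ?\<tau> = "Transposition.transpose m n"
    let ?f = "\<lambda>x::real^'n. \<chi> i. x $ ?\<tau> i"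
    have lin: "linear ?f"
      by (rule linearI) (simp_all add: vec_eq_iff)
    have "matrix ?f = (\<chi> i. mat 1 $ ?\<tau> i)"
      by (auto simp: matrix_def mat_def axis_def vec_eq_iff)
    moreover have "\<dots> = (\<chi> i. (mat 1 :: real^'n^'n) $ ?\<tau> i)" ..
    ultimately have det: "\<bar>det (matrix ?f)\<bar> = 1"
      by (simp add: det_permute_rows permutes_swap_id sign_swap_id abs_mult)
    have "measure lebesgue (?f ` cbox a b) = measure lebesgue (cbox a b)" for a b
    proof (cases "cbox a b = {}")
      case False
      have eq: "?f ` cbox a b = cbox (?f a) (?f b)"
      proof (intro equalityI subsetI)
        fix x assume "x \<in> cbox (?f a) (?f b)"
        hence "?f x \<in> cbox a b"
          by (auto simp: mem_box_cart) (metis transpose_involutory)+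
        thus "x \<in> ?f ` cbox a b"
          by (rule rev_image_eqI) (simp add: vec_eq_iff)
      qed (auto simp: mem_box_cart)
      hence "cbox (?f a) (?f b) \<noteq> {}" using False by blast
      thus ?thesis
        using False prod.permute[OF permutes_swap_id, of m UNIV n "\<lambda>i. b $ i - a $ i"]
        by (simp add: eq content_cbox_cart o_def)
    qed auto
    with lin det show "Q ?f"
      unfolding Q_def using measure_linear_image_if_unit_det by blast
  next
    fix m n :: 'n
    assume mn: "m \<noteq> n"
    let ?f = "\<lambda>x::real^'n. \<chi> i. if i = m then x $ m + x $ n else x $ i"
    have lin: "linear ?f"
      by (rule linearI) (auto simp: vec_eq_iff algebra_simps)
    have "matrix ?f = (\<chi> k. if k = m then row m (mat 1) + 1 *s row n (mat 1) else row k (mat 1))"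
      using mn by (auto simp: matrix_def mat_def axis_def vec_eq_iff row_def)
    hence det: "\<bar>det (matrix ?f)\<bar> = 1"
      using det_row_operation[OF mn, of "mat 1" "1::real"] by simp
    have "measure lebesgue (?f ` cbox a b) = measure lebesgue (cbox a b)" for a b
    proof (cases "cbox a b = {}")
      case False
      \<comment> \<open>The volume of a sheared box is translation invariant, so the lower corner may be taken as 0.\<close>
      have box: "cbox a b = (+) a ` cbox 0 (b - a)"
        using cbox_translation[of a 0 "b - a"] by simp
      have "?f ` (+) a ` cbox 0 (b - a) = (+) (?f a) ` ?f ` cbox 0 (b - a)"
        by (simp add: image_image linear_add[OF lin])
      moreover have "cbox 0 (b - a) \<noteq> {}" using False box by auto
      ultimately show ?thesis
        using measure_shear_interval[OF mn, of 0 "b - a"]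
        by (simp add: box measure_translation)
    qed auto
    with lin det show "Q ?f"
      unfolding Q_def using measure_linear_image_if_unit_det by blast
  qed
  thus ?thesis using assms by (simp add: Q_def)
qed

section \<open>Regular simplices\<close>

text \<open>For a regular simplex with vertices on the unit sphere, the barycentric coordinate of \<open>z\<close> with
  respect to the vertex \<open>v\<close> depends on \<open>v\<close> and \<open>z\<close> only; \<open>bary_reconstruction\<close> identifies this formula
  with the coordinate.\<close>

definition bary :: "real ^ 'n \<Rightarrow> real ^ 'n \<Rightarrow> real" where
  "bary v z = (1 + CARD('n) * (v \<bullet> z)) / (CARD('n) + 1)"

lemma simplex_vertices_finite: "simplex_vertices X \<Longrightarrow> finite X"
  by (simp add: simplex_vertices_def card_ge_0_finite)

lemma simplex_vertices_affine_hull: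
  fixes X :: "(real ^ 'n) set"
  shows "simplex_vertices X \<Longrightarrow> affine hull X = UNIV"
  by (intro affine_independent_span_eq) (simp_all add: simplex_vertices_def)

lemma simplex_vertices_affine_combination:
  fixes X :: "(real ^ 'n) set"
  assumes "simplex_vertices X"
  obtains u where "sum u X = 1" "(\<Sum>v\<in>X. u v *\<^sub>R v) = z"
  using simplex_vertices_affine_hull[OF assms] affine_hull_finite[OF simplex_vertices_finite[OF assms]]
  by blast

text \<open>Equal distances on the unit sphere mean that all inner products of distinct vertices are one
  number \<open>c\<close>.  Then every vertex has the same inner product \<open>1 + n c\<close> with the sum \<open>s\<close> of the vertices.
  Since the origin is an affine combination of the vertices, this common value is 0; hence
  \<open>s \<bullet> s = 0\<close> and \<open>c = - 1 / n\<close>.\<close>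

lemma regular_inscribed_centered_inner:
  fixes X :: "(real ^ 'n) set"
  assumes "regular_inscribed X"
  shows "(\<Sum>v\<in>X. v) = 0 \<and> (\<forall>v\<in>X. \<forall>w\<in>X. v \<noteq> w \<longrightarrow> v \<bullet> w = - 1 / CARD('n))"
proof -
  obtain d where S: "simplex_vertices X" and unit: "\<And>v. v \<in> X \<Longrightarrow> v \<bullet> v = 1"
    and d: "\<And>v w. v \<in> X \<Longrightarrow> w \<in> X \<Longrightarrow> v \<noteq> w \<Longrightarrow> dist v w = d"
    using assms by (auto simp: regular_inscribed_def subset_iff norm_eq_1)
  have fin: "finite X" and card: "card X = CARD('n) + 1"
    using simplex_vertices_finite[OF S] S by (auto simp: simplex_vertices_def)
  define c where "c = 1 - d\<^sup>2 / 2"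
  have c: "v \<bullet> w = c" if "v \<in> X" "w \<in> X" "v \<noteq> w" for v w
  proof -
    have "d\<^sup>2 = (v - w) \<bullet> (v - w)"
      using d[OF that] by (simp add: dist_norm flip: power2_norm_eq_inner)
    thus ?thesis
      using unit that by (simp add: c_def inner_diff inner_commute field_simps)
  qed
  define s where "s = (\<Sum>v\<in>X. v)"
  have vs: "v \<bullet> s = 1 + CARD('n) * c" if "v \<in> X" for v
  proof -
    have "v \<bullet> s = v \<bullet> v + (\<Sum>w\<in>X - {v}. v \<bullet> w)"
      unfolding s_def inner_sum_right using sum.remove[OF fin that] by simp
    also have "(\<Sum>w\<in>X - {v}. v \<bullet> w) = (\<Sum>w\<in>X - {v}. c)"
      by (intro sum.cong) (use c that in auto)
    finally show ?thesis using that card fin by (simp add: unit)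
  qed
  obtain u where u: "sum u X = 1" "(\<Sum>v\<in>X. u v *\<^sub>R v) = 0"
    using simplex_vertices_affine_combination[OF S] by blast
  have "0 = (\<Sum>v\<in>X. u v *\<^sub>R v) \<bullet> s"
    by (simp add: u)
  also have "\<dots> = (\<Sum>v\<in>X. u v * (1 + CARD('n) * c))"
    unfolding inner_sum_left by (intro sum.cong) (simp_all add: vs)
  also have "\<dots> = 1 + CARD('n) * c"
    by (simp add: u(1) flip: sum_distrib_right)
  finally have zero: "1 + CARD('n) * c = 0" by simp
  have "s \<bullet> s = (\<Sum>v\<in>X. v \<bullet> s)"
    by (simp add: s_def inner_sum_left)
  also have "\<dots> = 0" by (simp add: vs zero)
  finally have "s = 0" by simp
  moreover have "c = - 1 / CARD('n)"
    using zero by (simp add: field_simps)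
  ultimately show ?thesis using c by (simp add: s_def)
qed

lemmas regular_inscribed_sum = regular_inscribed_centered_inner[THEN conjunct1]
lemmas regular_inscribed_inner =
  regular_inscribed_centered_inner[THEN conjunct2, rule_format]

lemma regular_inscribed_simplex: "regular_inscribed X \<Longrightarrow> simplex_vertices X"
  by (simp add: regular_inscribed_def)

lemma regular_inscribed_norm: "regular_inscribed X \<Longrightarrow> v \<in> X \<Longrightarrow> norm v = 1"
  by (auto simp: regular_inscribed_def)

lemma bary_vertex:
  assumes "regular_inscribed X" "v \<in> X" "w \<in> X"
  shows "bary v w = (if v = w then 1 else 0)"
  using regular_inscribed_inner[OF assms] regular_inscribed_norm[OF assms(1,2)]
  by (auto simp: bary_def norm_eq_1)

lemma bary_affine_combination:
  assumes X: "regular_inscribed X" and v: "v \<in> X" and u: "sum u X = 1"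
  shows "bary v (\<Sum>w\<in>X. u w *\<^sub>R w) = u v"
proof -
  have fin: "finite X"
    using X regular_inscribed_simplex simplex_vertices_finite by blast
  have aff: "bary v (\<Sum>w\<in>X. u w *\<^sub>R w) = (\<Sum>w\<in>X. u w * bary v w)"
  proof -
    have "(\<Sum>w\<in>X. u w * bary v w) = (\<Sum>w\<in>X. u w + CARD('a) * (u w * (v \<bullet> w))) / (CARD('a) + 1)"
      by (simp add: bary_def sum_divide_distrib algebra_simps)
    also have "\<dots> = bary v (\<Sum>w\<in>X. u w *\<^sub>R w)"
      by (simp add: bary_def sum.distrib u inner_sum_right sum_distrib_left)
    finally show ?thesis ..
  qed
  also have "\<dots> = (\<Sum>w\<in>X. if w = v then u w else 0)"
    by (intro sum.cong) (auto simp: bary_vertex[OF X v])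
  also have "\<dots> = u v" using fin v by simp
  finally show ?thesis .
qed

lemma bary_reconstruction:
  assumes X: "regular_inscribed X"
  shows "(\<Sum>v\<in>X. bary v z) = 1" "(\<Sum>v\<in>X. bary v z *\<^sub>R v) = z"
proof -
  obtain u where u: "sum u X = 1" "(\<Sum>v\<in>X. u v *\<^sub>R v) = z"
    using simplex_vertices_affine_combination[OF regular_inscribed_simplex[OF X]] by blast
  have "bary v z = u v" if "v \<in> X" for v
    using bary_affine_combination[OF X that u(1)] u(2) by simp
  thus "(\<Sum>v\<in>X. bary v z) = 1" "(\<Sum>v\<in>X. bary v z *\<^sub>R v) = z"
    using u by auto
qed

text \<open>Take the inner product of the expansion of \<open>z\<close> in barycentric coordinates with \<open>z\<close> itself; the
  part that is linear in \<open>v \<bullet> z\<close> vanishes because the vertices sum to 0.\<close>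

lemma regular_inscribed_tight_frame:
  fixes X :: "(real ^ 'n) set"
  assumes X: "regular_inscribed X"
  shows "(\<Sum>v\<in>X. (v \<bullet> z)\<^sup>2) = (CARD('n) + 1) / CARD('n) * (norm z)\<^sup>2"
proof -
  let ?n = "real CARD('n)"
  have sum0: "(\<Sum>v\<in>X. v \<bullet> z) = 0"
    using regular_inscribed_sum[OF X] by (simp flip: inner_sum_left)
  have "(norm z)\<^sup>2 = (\<Sum>v\<in>X. bary v z *\<^sub>R v) \<bullet> z"
    by (simp add: bary_reconstruction[OF X] power2_norm_eq_inner)
  also have "\<dots> = (\<Sum>v\<in>X. (v \<bullet> z) + ?n * (v \<bullet> z)\<^sup>2) / (?n + 1)"
    by (simp add: inner_sum_left sum_divide_distrib bary_def power2_eq_square algebra_simps)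
  also have "\<dots> = ?n * (\<Sum>v\<in>X. (v \<bullet> z)\<^sup>2) / (?n + 1)"
    by (simp add: sum.distrib sum0 sum_distrib_left)
  finally show ?thesis by (simp add: field_simps)
qed

text \<open>The unit ball is therefore the set where the squares of the barycentric coordinates sum to at
  most 1.  This description is invariant under affine maps and drives both norm estimates.\<close>

lemma sum_bary_squares:
  fixes X :: "(real ^ 'n) set"
  assumes X: "regular_inscribed X"
  shows "(\<Sum>v\<in>X. (bary v z)\<^sup>2) = (1 + CARD('n) * (norm z)\<^sup>2) / (CARD('n) + 1)"
proof -
  let ?n = "real CARD('n)"
  have sum0: "(\<Sum>v\<in>X. v \<bullet> z) = 0"
    using regular_inscribed_sum[OF X] by (simp flip: inner_sum_left)
  have card: "real (card X) = ?n + 1"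
    using regular_inscribed_simplex[OF X] by (simp add: simplex_vertices_def)
  have "(\<Sum>v\<in>X. (bary v z)\<^sup>2) = (\<Sum>v\<in>X. 1 + 2 * ?n * (v \<bullet> z) + ?n\<^sup>2 * (v \<bullet> z)\<^sup>2) / (?n + 1)\<^sup>2"
    by (simp add: sum_divide_distrib bary_def power2_eq_square algebra_simps)
  also have "(\<Sum>v\<in>X. 1 + 2 * ?n * (v \<bullet> z) + ?n\<^sup>2 * (v \<bullet> z)\<^sup>2) =
      real (card X) + ?n\<^sup>2 * (\<Sum>v\<in>X. (v \<bullet> z)\<^sup>2)"
    by (simp add: sum.distrib sum0 flip: sum_distrib_left)
  also have "\<dots> = (?n + 1) * (1 + ?n * (norm z)\<^sup>2)"
    unfolding regular_inscribed_tight_frame[OF X] card by (simp add: power2_eq_square field_simps)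
  finally show ?thesis by (simp add: power2_eq_square)
qed

lemma regular_inscribed_face_sum_norm:
  fixes X :: "(real ^ 'n) set"
  assumes X: "regular_inscribed X" and M: "M \<subseteq> X"
  shows "(norm (\<Sum>v\<in>M. v))\<^sup>2 = card M * (real CARD('n) + 1 - real (card M)) / CARD('n)"
proof -
  have fin: "finite M"
    using X M regular_inscribed_simplex simplex_vertices_finite finite_subset by blast
  have "v \<bullet> (\<Sum>w\<in>M. w) = (real CARD('n) + 1 - real (card M)) / CARD('n)" if v: "v \<in> M" for v
  proof -
    have "v \<bullet> (\<Sum>w\<in>M. w) = v \<bullet> v + (\<Sum>w\<in>M - {v}. v \<bullet> w)"
      unfolding inner_sum_right using sum.remove[OF fin v] by simp
    also have "(\<Sum>w\<in>M - {v}. v \<bullet> w) = (\<Sum>w\<in>M - {v}. - 1 / CARD('n))"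
      by (intro sum.cong) (use regular_inscribed_inner[OF X] v M in auto)
    also have "v \<bullet> v = 1"
      using regular_inscribed_norm[OF X] v M by (auto simp: norm_eq_1)
    finally have "v \<bullet> (\<Sum>w\<in>M. w) = 1 - real (card (M - {v})) / CARD('n)"
      by simp
    moreover have "real (card (M - {v})) = real (card M) - 1"
      using v fin card_Suc_Diff1[of M v] by linarith
    ultimately show ?thesis
      by (simp add: field_simps)
  qed
  hence "(norm (\<Sum>v\<in>M. v))\<^sup>2 = (\<Sum>v\<in>M. (real CARD('n) + 1 - real (card M)) / CARD('n))"
    by (simp add: power2_norm_eq_inner inner_sum_left)
  thus ?thesis by simp
qed

section \<open>Minimal ellipsoids of simplices\<close>

abbreviation affine_map :: "real ^ 'n \<Rightarrow> real ^ 'n ^ 'n \<Rightarrow> real ^ 'n \<Rightarrow> real ^ 'n" where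
  "affine_map c A z \<equiv> c + A *v z"

lemma matrix_inv_inverse:
  "invertible A \<Longrightarrow> A ** matrix_inv A = mat 1 \<and> matrix_inv A ** A = mat 1"
  unfolding invertible_def matrix_inv_def
  by (rule someI_ex[of "\<lambda>B. A ** B = mat 1 \<and> B ** A = mat 1"])

lemma affine_map_inverse:
  assumes "invertible A"
  shows "affine_map c A z = x \<longleftrightarrow> z = matrix_inv A *v (x - c)"
proof -
  have *: "A ** matrix_inv A = mat 1" "matrix_inv A ** A = mat 1"
    using matrix_inv_inverse[OF assms] by auto
  have "A *v (matrix_inv A *v y) = y" "matrix_inv A *v (A *v y) = y" for y
    by (simp_all add: * matrix_vector_mul_assoc)
  thus ?thesis by (metis add.commute add_diff_cancel_left' diff_add_cancel)
qed

lemma inj_affine_map: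
  assumes "invertible A"
  shows "inj (affine_map c A)"
  by (rule injI) (use affine_map_inverse[OF assms] in metis)

lemma affine_map_affine_combination:
  assumes "sum u S = 1"
  shows "affine_map c A (\<Sum>v\<in>S. u v *\<^sub>R f v) = (\<Sum>v\<in>S. u v *\<^sub>R affine_map c A (f v))"
proof -
  have "A *v (\<Sum>v\<in>S. u v *\<^sub>R f v) = (\<Sum>v\<in>S. u v *\<^sub>R (A *v f v))"
    by (simp add: linear_sum[OF matrix_vector_mul_linear] matrix_vector_mult_scaleR)
  moreover have "(\<Sum>v\<in>S. u v *\<^sub>R c) = c"
    by (simp only: assms scaleR_left.sum[symmetric] scaleR_one)
  ultimately show ?thesis
    by (simp add: scaleR_add_right sum.distrib)
qed

text \<open>The map that sends a point to the combination of the vertices of \<open>X\<close> with the same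
  barycentric coordinates is affine by the formula for \<open>bary\<close>.  It is onto, since every point is an
  affine combination of the vertices of \<open>X\<close>.\<close>

lemma simplex_affine_image_of_regular:
  fixes X R :: "(real ^ 'n) set"
  assumes R: "regular_inscribed R" and X: "simplex_vertices X"
  obtains A c where "invertible A" "X = affine_map c A ` R"
proof -
  note Rs = regular_inscribed_simplex[OF R]
  have "card R = card X" "finite R" "finite X"
    using Rs X simplex_vertices_finite by (auto simp: simplex_vertices_def)
  then obtain \<sigma> where \<sigma>: "bij_betw \<sigma> R X"
    using finite_same_card_bij by blast
  let ?n = "real CARD('n)"
  define L where "L z = (\<Sum>v\<in>R. (?n / (?n + 1) * (v \<bullet> z)) *\<^sub>R \<sigma> v)" for z
  define c where "c = (\<Sum>v\<in>R. (1 / (?n + 1)) *\<^sub>R \<sigma> v)"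
  have lin: "linear L"
    unfolding L_def
    by (rule linearI)
      (simp_all add: inner_add_right distrib_left scaleR_add_left sum.distrib scaleR_sum_right mult.left_commute)
  define A where "A = matrix L"
  have F: "affine_map c A z = (\<Sum>v\<in>R. bary v z *\<^sub>R \<sigma> v)" for z
  proof -
    have "affine_map c A z = c + L z"
      by (simp add: A_def matrix_works lin)
    also have "\<dots> = (\<Sum>v\<in>R. (1 / (?n + 1) + ?n / (?n + 1) * (v \<bullet> z)) *\<^sub>R \<sigma> v)"
      by (simp add: c_def L_def scaleR_add_left sum.distrib)
    also have "\<dots> = (\<Sum>v\<in>R. bary v z *\<^sub>R \<sigma> v)"
      by (simp add: bary_def add_divide_distrib add.commute)
    finally show ?thesis .
  qed
  have vertex: "affine_map c A v = \<sigma> v" if "v \<in> R" for v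
  proof -
    have "affine_map c A v = (\<Sum>w\<in>R. if w = v then \<sigma> w else 0)"
      unfolding F by (intro sum.cong) (use bary_vertex[OF R] that in auto)
    thus ?thesis using that \<open>finite R\<close> by simp
  qed
  have "\<exists>z. affine_map c A z = x" for x
  proof -
    obtain u where u: "sum u X = 1" "(\<Sum>w\<in>X. u w *\<^sub>R w) = x"
      using simplex_vertices_affine_combination[OF X] .
    have sum1: "(\<Sum>v\<in>R. u (\<sigma> v)) = 1"
      using sum.reindex_bij_betw[OF \<sigma>, of u] u(1) by simp
    have "affine_map c A (\<Sum>v\<in>R. u (\<sigma> v) *\<^sub>R v) = (\<Sum>v\<in>R. u (\<sigma> v) *\<^sub>R \<sigma> v)"
      unfolding affine_map_affine_combination[OF sum1] by (intro sum.cong) (simp_all add: vertex)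
    also have "\<dots> = x"
      using sum.reindex_bij_betw[OF \<sigma>, of "\<lambda>w. u w *\<^sub>R w"] u(2) by simp
    finally show ?thesis by blast
  qed
  hence "surj ((*v) A)"
    unfolding surj_def by (metis add_left_imp_eq)
  hence "invertible A"
    by (metis invertible_right_inverse matrix_right_invertible_surjective)
  moreover have "X = affine_map c A ` R"
    using \<sigma> vertex by (auto simp: bij_betw_def image_iff)
  ultimately show thesis by (rule that)
qed

text \<open>Summing the squared lengths of the image vertices, the terms that mix \<open>d\<close> and \<open>D\<close> cancel because
  the vertices are centered, and the tight frame identity turns the rest into a multiple of the squared
  Frobenius norm of \<open>D\<close>.  This norm is thus at most \<open>n\<close>.\<close>

lemma abs_det_le_1_if_regular_into_ball:
  fixes D :: "real ^ 'n ^ 'n"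
  assumes R: "regular_inscribed R" and ball: "\<And>v. v \<in> R \<Longrightarrow> norm (affine_map d D v) \<le> 1"
  shows "\<bar>det D\<bar> \<le> 1"
proof (rule abs_det_le_1_if_Frobenius_norm_le)
  let ?n = "real CARD('n)"
  have card: "real (card R) = ?n + 1"
    using regular_inscribed_simplex[OF R] by (simp add: simplex_vertices_def)
  have zero: "(\<Sum>v\<in>R. D *v v) = 0"
    using regular_inscribed_sum[OF R] by (simp flip: linear_sum[OF matrix_vector_mul_linear])
  have "(?n + 1) / ?n * (\<Sum>i\<in>UNIV. (norm (D $ i))\<^sup>2) = (\<Sum>i\<in>UNIV. \<Sum>v\<in>R. (v \<bullet> D $ i)\<^sup>2)"
    by (simp add: regular_inscribed_tight_frame[OF R] sum_distrib_left add.commute)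
  also have "\<dots> = (\<Sum>v\<in>R. \<Sum>i\<in>UNIV. (v \<bullet> D $ i)\<^sup>2)"
    by (rule sum.swap)
  also have "\<dots> = (\<Sum>v\<in>R. (norm (D *v v))\<^sup>2)"
    unfolding power2_norm_eq_inner
    by (subst inner_vec_def) (simp add: matrix_mult_dot inner_commute power2_eq_square)
  also have "\<dots> \<le> (\<Sum>v\<in>R. (norm (D *v v))\<^sup>2) + card R * (norm d)\<^sup>2"
    by simp
  also have "\<dots> = (\<Sum>v\<in>R. (norm (affine_map d D v))\<^sup>2)"
  proof -
    have "(norm (affine_map d D v))\<^sup>2 = (norm (D *v v))\<^sup>2 + (norm d)\<^sup>2 + 2 * (d \<bullet> (D *v v))" for v
      by (simp add: power2_norm_eq_inner inner_add inner_commute)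
    moreover have "(\<Sum>v\<in>R. 2 * (d \<bullet> (D *v v))) = 0"
      using zero by (simp only: sum_distrib_left[symmetric] inner_sum_right[symmetric]) simp
    ultimately show ?thesis
      by (simp add: sum.distrib)
  qed
  also have "\<dots> \<le> (\<Sum>v\<in>R. 1)"
    by (intro sum_mono) (simp add: ball power_le_one)
  finally have "(?n + 1) / ?n * (\<Sum>i\<in>UNIV. (norm (D $ i))\<^sup>2) \<le> ?n + 1"
    by (simp add: card)
  hence "(?n + 1) * (\<Sum>i\<in>UNIV. (norm (D $ i))\<^sup>2) \<le> (?n + 1) * ?n"
    by (simp add: field_simps)
  thus "(\<Sum>i\<in>UNIV. (norm (D $ i))\<^sup>2) \<le> ?n"
    by (rule mult_left_le_imp_le) simp
qed

lemma measure_affine_map_cball: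
  fixes A :: "real ^ 'n ^ 'n"
  shows "measure lebesgue (affine_map c A ` cball 0 1) =
    \<bar>det A\<bar> * measure lebesgue (cball (0 :: real ^ 'n) 1)"
proof -
  have "affine_map c A ` cball 0 1 = (+) c ` (*v) A ` cball 0 1"
    by (simp add: image_image)
  thus ?thesis
    by (simp add: measure_translation measure_matrix_image)
qed

text \<open>Pull back by the map that defines a competing ellipsoid: the vertices of the regular simplex are
  then mapped into the unit ball, so the preceding determinant bound compares the volumes.\<close>

lemma minimal_ellipsoid_of_affine_image:
  fixes A :: "real ^ 'n ^ 'n"
  assumes R: "regular_inscribed R" and A: "invertible A"
  shows "minimal_ellipsoid (convex hull (affine_map c A ` R)) (affine_map c A ` cball 0 1)"
  unfolding minimal_ellipsoid_def
proof (intro conjI allI impI)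
  show "ellipsoid (affine_map c A ` cball 0 1)"
    using A by (auto simp: ellipsoid_def)
  have "affine_map c A ` cball 0 1 = (+) c ` (*v) A ` cball 0 1"
    by (simp add: image_image)
  hence "convex (affine_map c A ` cball 0 1)"
    by (simp add: convex_translation convex_linear_image)
  thus "convex hull (affine_map c A ` R) \<subseteq> affine_map c A ` cball 0 1"
    using regular_inscribed_norm[OF R] by (intro hull_minimal image_mono) auto
next
  fix E assume E: "ellipsoid E \<and> convex hull (affine_map c A ` R) \<subseteq> E"
  then obtain B b where B: "invertible B" "E = affine_map b B ` cball 0 1"
    by (auto simp: ellipsoid_def)
  define D where "D = matrix_inv B ** A"
  define d where "d = matrix_inv B *v (c - b)"
  have BD: "B ** D = A"
    using matrix_inv_inverse[OF B(1)] by (simp add: D_def matrix_mul_assoc)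
  have "norm (affine_map d D v) \<le> 1" if "v \<in> R" for v
  proof -
    have "affine_map c A v \<in> E"
      using E that hull_subset[of "affine_map c A ` R" convex] by auto
    then obtain u where u: "norm u \<le> 1" "affine_map b B u = affine_map c A v"
      using B(2) by auto
    have "u = matrix_inv B *v (affine_map c A v - b)"
      using u(2) affine_map_inverse[OF B(1)] by metis
    also have "\<dots> = affine_map d D v"
      by (simp add: d_def D_def matrix_vector_mult_diff_distrib matrix_vector_right_distrib
          flip: matrix_vector_mul_assoc)
    finally show ?thesis using u(1) by simp
  qed
  hence "\<bar>det D\<bar> \<le> 1"
    by (rule abs_det_le_1_if_regular_into_ball[OF R])
  hence "\<bar>det A\<bar> \<le> \<bar>det B\<bar>"
    unfolding BD[symmetric] by (simp add: det_mul abs_mult mult_left_le)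
  thus "measure lebesgue (affine_map c A ` cball 0 1) \<le> measure lebesgue E"
    unfolding B(2) measure_affine_map_cball by (intro mult_right_mono) auto
qed

lemma frontier_affine_map_cball:
  fixes A :: "real ^ 'n ^ 'n"
  assumes A: "invertible A" and y: "y \<in> frontier (affine_map c A ` cball 0 1)"
  obtains z where "norm z = 1" "y = affine_map c A z"
proof -
  have bij: "bij ((*v) A)"
    using A invertible_eq_bij by blast
  have "affine_map c A ` cball 0 1 = (+) c ` (*v) A ` cball 0 1"
    by (simp add: image_image)
  moreover have "closed ((*v) A ` cball 0 1)"
    by (intro compact_imp_closed compact_continuous_image linear_continuous_on) (auto simp: linear_linear)
  ultimately have "frontier (affine_map c A ` cball 0 1) = (+) c ` ((*v) A ` cball 0 1 - (*v) A ` ball 0 1)"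
    using bij by (simp only: frontier_translation)
      (simp add: frontier_def interior_bijective_linear_image)
  also have "(*v) A ` cball 0 1 - (*v) A ` ball 0 1 = (*v) A ` (cball 0 1 - ball 0 1)"
    using bij by (simp add: image_set_diff bij_is_inj)
  finally have "y \<in> affine_map c A ` (cball 0 1 - ball 0 1)"
    using y by (simp add: image_image)
  then obtain z where "z \<in> cball 0 1 - ball 0 1" "y = affine_map c A z"
    by blast
  thus thesis by (intro that[of z]) auto
qed

lemma centroid_affine_map:
  assumes "finite M" "M \<noteq> {}" "invertible A"
  shows "centroid (affine_map c A ` M) = affine_map c A (centroid M)"
proof -
  have inj: "inj_on (affine_map c A) M"
    using inj_affine_map[OF assms(3)] inj_on_subset by blast
  have "(\<Sum>v\<in>M. 1 / real (card M)) = 1" using assms by simp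
  from affine_map_affine_combination[OF this, of c A "\<lambda>v. v"] show ?thesis
    by (simp add: centroid_def card_image[OF inj] sum.reindex[OF inj] scaleR_sum_right)
qed

text \<open>In the coordinates of the regular simplex the assigned point is a multiple of the sum of the \<open>m\<close>
  selected vertices, and it has norm 1.  This is a quadratic equation for \<open>t\<close> with one positive root.
  The number \<open>2 * t - 1\<close> is the value at this point of the affine function that is \<open>- 1\<close> on the
  selected vertices and \<open>1\<close> on the others.\<close>
lemma assigned_point_parameter:
  fixes A :: "real ^ 'n ^ 'n" and y :: "real ^ 'n"
  assumes R: "regular_inscribed R" and A: "invertible A" and X: "X = affine_map c A ` R"
    and y: "assigned_point X (affine_map c A ` cball 0 1) M y"
    and M: "M \<subseteq> X" "card M = m" "1 \<le> m" "m \<le> CARD('n)"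
  obtains t where "y = centroid M + t *\<^sub>R (centroid (X - M) - centroid M)"
    "2 * t - 1 = 2 * sqrt (CARD('n)) / (real CARD('n) + 1) * sqrt (m * (real CARD('n) + 1 - m))
                 + (1 - 2 * real m / (real CARD('n) + 1))"
proof -
  let ?n = "real CARD('n)"
  obtain t where yfr: "y \<in> frontier (affine_map c A ` cball 0 1)" and t: "t > 0"
    and yt: "y = centroid M + t *\<^sub>R (centroid (X - M) - centroid M)"
    using y by (auto simp: assigned_point_def)
  obtain z where z: "norm z = 1" "y = affine_map c A z"
    using frontier_affine_map_cball[OF A yfr] .
  have finR: "finite R" and cardR: "card R = CARD('n) + 1"
    using regular_inscribed_simplex[OF R] simplex_vertices_finite by (auto simp: simplex_vertices_def)
  define K where "K = {v \<in> R. affine_map c A v \<in> M}"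
  have K: "K \<subseteq> R" "M = affine_map c A ` K" "X - M = affine_map c A ` (R - K)"
    using M(1) inj_affine_map[OF A, of c] by (auto simp: K_def X dest: injD)
  have cK: "card K = m"
    using M(2) K(2) card_image[OF inj_on_subset[OF inj_affine_map[OF A] subset_UNIV], of c K] by simp
  have finK: "finite K" using K(1) finR finite_subset by blast
  have cRK: "card (R - K) = CARD('n) + 1 - m"
    using cK cardR finK K(1) by (simp add: card_Diff_subset)
  have ne: "K \<noteq> {}" "R - K \<noteq> {}"
    using cK cRK M by (metis One_nat_def card.empty not_one_le_zero, metis Suc_eq_plus1 card.empty diff_is_0_eq not_less_eq_eq)
  define s where "s = (\<Sum>v\<in>K. v)"
  have "(\<Sum>v\<in>R - K. v) = - s"
    using sum_diff[OF finR K(1), of "\<lambda>v. v"] regular_inscribed_sum[OF R] by (simp add: s_def)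
  hence cen: "centroid K = (1 / m) *\<^sub>R s" "centroid (R - K) = - (1 / (?n + 1 - m)) *\<^sub>R s"
    using M by (simp_all add: centroid_def cK cRK s_def of_nat_diff)
  have "affine_map c A z = affine_map c A (centroid K) + t *\<^sub>R (affine_map c A (centroid (R - K)) - affine_map c A (centroid K))"
  proof -
    have "centroid M = affine_map c A (centroid K)"
      using finK ne A unfolding K(2) by (intro centroid_affine_map)
    moreover have "centroid (X - M) = affine_map c A (centroid (R - K))"
      using finR ne A unfolding K(3) by (intro centroid_affine_map) auto
    ultimately show ?thesis using yt z(2) by simp
  qed
  also have "\<dots> = affine_map c A (centroid K + t *\<^sub>R (centroid (R - K) - centroid K))"
    by (simp add: matrix_vector_right_distrib matrix_vector_mult_scaleR matrix_vector_mult_diff_distrib)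
  finally have "z = centroid K + t *\<^sub>R (centroid (R - K) - centroid K)"
    using injD[OF inj_affine_map[OF A]] by blast
  also have "\<dots> = ((1 - t) / m - t / (?n + 1 - m)) *\<^sub>R s"
    by (simp add: cen algebra_simps diff_divide_distrib)
  finally have zs: "z = ((1 - t) / m - t / (?n + 1 - m)) *\<^sub>R s" .
  define p q where "p = real m" and "q = ?n + 1 - p"
  have pq: "p \<ge> 1" "q \<ge> 1" "?n = p + q - 1"
    using M by (simp_all add: p_def q_def)
  have "1 = ((1 - t) / p - t / q)\<^sup>2 * (norm s)\<^sup>2"
    using z(1) by (simp add: zs p_def q_def flip: power_mult_distrib) (metis abs_mult abs_norm_cancel power2_abs one_power2)
  also have "(norm s)\<^sup>2 = p * q / ?n"
    using regular_inscribed_face_sum_norm[OF R K(1)] by (simp add: s_def cK p_def q_def)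
  also have "((1 - t) / p - t / q)\<^sup>2 * (p * q / ?n) = ((?n + 1) * t - q)\<^sup>2 / (?n * (p * q))"
  proof -
    have "(1 - t) / p - t / q = (q - (?n + 1) * t) / (p * q)"
      using pq by (simp add: field_simps)
    hence "((1 - t) / p - t / q)\<^sup>2 = ((?n + 1) * t - q)\<^sup>2 / (p * q)\<^sup>2"
      by (simp add: power_divide power2_commute)
    thus ?thesis using pq by (simp add: power2_eq_square field_simps)
  qed
  finally have "1 = ((?n + 1) * t - q)\<^sup>2 / (?n * (p * q))" .
  hence quad: "((?n + 1) * t - q)\<^sup>2 = ?n * (p * q)"
  proof -
    assume "1 = ((?n + 1) * t - q)\<^sup>2 / (?n * (p * q))"
    moreover have "?n * (p * q) \<noteq> 0" using pq by simp
    ultimately show ?thesis by (simp only: one_eq_divide_iff)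
  qed
  have root: "(?n + 1) * t - q = sqrt (?n * (p * q))"
  proof (rule ccontr)
    assume "(?n + 1) * t - q \<noteq> sqrt (?n * (p * q))"
    \<comment> \<open>For the other root, \<open>(?n + 1) * t\<close> is \<open>q\<close> minus a number that is at least \<open>q\<close>.\<close>
    hence "(?n + 1) * t - q = - sqrt (?n * (p * q))"
      by (metis quad real_sqrt_abs abs_if minus_minus)
    moreover have "q\<^sup>2 \<le> ?n * (p * q)"
    proof -
      have "q \<le> (p + q - 1) * p"
        using pq mult_mono[of 0 "p - 1" 0 "p + q"] by (simp add: algebra_simps)
      thus ?thesis using pq by (simp add: power2_eq_square mult.assoc[symmetric] mult_right_mono)
    qed
    hence "q \<le> sqrt (?n * (p * q))"
      using pq by (simp add: real_le_rsqrt)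
    ultimately have "(?n + 1) * t \<le> 0" by linarith
    thus False using t by (simp add: mult_le_0_iff)
  qed
  have "2 * t - 1 = 2 * sqrt ?n / (?n + 1) * sqrt (p * q) + (1 - 2 * p / (?n + 1))"
  proof -
    have "(?n + 1) * (2 * t - 1) = 2 * ((?n + 1) * t - q) + (?n + 1 - 2 * p)"
      by (simp add: q_def algebra_simps)
    also have "\<dots> = 2 * (sqrt ?n * sqrt (p * q)) + (?n + 1 - 2 * p)"
      unfolding root real_sqrt_mult[of ?n] ..
    finally have "2 * t - 1 = (2 * (sqrt ?n * sqrt (p * q)) + (?n + 1 - 2 * p)) / (?n + 1)"
      by (simp add: nonzero_eq_divide_eq mult.commute)
    thus ?thesis
      by (simp add: add_divide_distrib diff_divide_distrib)
  qed
  with yt show thesis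
    by (intro that) (simp_all add: p_def q_def)
qed

section \<open>The largest value of psi at an integer\<close>

text \<open>This is \<open>psi\<close> with the absolute value dropped.  Unlike \<open>psi\<close>, it is concave on the whole interval
  \<open>[0, n + 1]\<close>.  With \<open>v = 1 - 2 * x / (n + 1)\<close> it is the inner product of \<open>(1, sqrt n)\<close> with the point
  of the upper unit half circle over \<open>v\<close>.\<close>

definition phi :: "nat \<Rightarrow> real \<Rightarrow> real" where
  "phi n x = 2 * sqrt (real n) / (real n + 1) * sqrt (x * (real n + 1 - x)) + (1 - 2 * x / (real n + 1))"

definition phi_peak :: "nat \<Rightarrow> real" where
  "phi_peak n = (real n + 1) / 2 - sqrt (real n + 1) / 2"

lemma phi_le_psi: "phi n x \<le> psi n x"
  by (simp add: phi_def psi_def)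

lemma psi_eq_phi: "x \<le> (real n + 1) / 2 \<Longrightarrow> psi n x = phi n x"
  by (simp add: phi_def psi_def)

text \<open>The half circle has its largest inner product with \<open>(1, sqrt n)\<close> in the direction of that vector,
  where \<open>v = 1 / sqrt (n + 1)\<close> and the value is \<open>sqrt (n + 1)\<close>.\<close>

lemma phi_le_phi_peak:
  assumes "0 \<le> x" "x \<le> real n + 1"
  shows "phi n x \<le> phi n (phi_peak n)"
proof -
  define N where "N = real n + 1"
  have N: "N > 0" "real n = N - 1" by (simp_all add: N_def)
  define v where "v = 1 - 2 * x / N"
  define w where "w = 2 * sqrt (x * (N - x)) / N"
  have "w\<^sup>2 = 4 * (x * (N - x)) / N\<^sup>2"
    using assms by (simp add: w_def power_mult_distrib power_divide N_def)
  hence vw: "v\<^sup>2 + w\<^sup>2 = 1"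
    using N by (simp add: v_def power2_eq_square field_simps)
  have "phi n x = v + sqrt n * w"
    by (simp add: phi_def v_def w_def N_def)
  also have "\<dots> \<le> sqrt N"
  proof (rule real_le_rsqrt)
    have "(v + sqrt n * w)\<^sup>2 + (sqrt n * v - w)\<^sup>2 = (1 + (sqrt n)\<^sup>2) * (v\<^sup>2 + w\<^sup>2)"
      by algebra
    also have "\<dots> = N"
      using N vw by simp
    finally have "(v + sqrt n * w)\<^sup>2 + (sqrt n * v - w)\<^sup>2 = N" .
    moreover have "0 \<le> (sqrt n * v - w)\<^sup>2"
      by (rule zero_le_power2)
    ultimately show "(v + sqrt n * w)\<^sup>2 \<le> N"
      by linarith
  qed
  also have "sqrt N = phi n (phi_peak n)"
  proof -
    have sq: "sqrt N * sqrt N = N" "sqrt N > 0" using N by simp_all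
    have "phi_peak n * (N - phi_peak n) = (N * N - sqrt N * sqrt N) / 4"
    proof -
      have *: "phi_peak n = N / 2 - sqrt N / 2" by (simp add: phi_peak_def N_def)
      show ?thesis unfolding * by (simp add: field_simps)
    qed
    also have "\<dots> = N * n / 4"
      by (simp only: sq(1) N(2)) (simp add: algebra_simps)
    finally have prod: "phi_peak n * (N - phi_peak n) = N * n / 4" .
    have "phi n (phi_peak n) = 2 * sqrt n / N * sqrt (N * n / 4) + (1 - 2 * phi_peak n / N)"
      unfolding prod[symmetric] by (simp add: phi_def N_def)
    also have "2 * sqrt n / N * sqrt (N * n / 4) = (sqrt n * sqrt n) * sqrt N / N"
      by (simp add: real_sqrt_mult real_sqrt_divide)
    also have "1 - 2 * phi_peak n / N = sqrt N / N"
      using N by (simp add: phi_peak_def field_simps)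
    also have "sqrt n * sqrt n * sqrt N / N + sqrt N / N = N * sqrt N / N"
      by (simp add: N_def distrib_right add_divide_distrib)
    also have "\<dots> = sqrt N"
      using N(1) by simp
    finally show ?thesis ..
  qed
  finally show ?thesis .
qed

text \<open>After squaring, the claim is the inequality between the geometric and the arithmetic mean of
  \<open>x * (N - y)\<close> and \<open>y * (N - x)\<close>.\<close>

lemma sqrt_parabola_concave:
  fixes x y l m N :: real
  assumes "0 \<le> x" "x \<le> N" "0 \<le> y" "y \<le> N" "0 \<le> l" "0 \<le> m" "l + m = 1"
  shows "l * sqrt (x * (N - x)) + m * sqrt (y * (N - y))
         \<le> sqrt ((l * x + m * y) * (N - (l * x + m * y)))"
proof (rule real_le_rsqrt)
  let ?X = "N - x" and ?Y = "N - y"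
  have "2 * (sqrt (x * ?X) * sqrt (y * ?Y)) = 2 * (sqrt (x * ?Y) * sqrt (y * ?X))"
    by (simp flip: real_sqrt_mult add: ac_simps)
  also have "\<dots> \<le> (sqrt (x * ?Y))\<^sup>2 + (sqrt (y * ?X))\<^sup>2"
    using sum_squares_bound[of "sqrt (x * ?Y)" "sqrt (y * ?X)"] by (simp add: ac_simps)
  finally have amgm: "2 * (sqrt (x * ?X) * sqrt (y * ?Y)) \<le> x * ?Y + y * ?X"
    using assms by simp
  have "(l * sqrt (x * ?X) + m * sqrt (y * ?Y))\<^sup>2
      = l\<^sup>2 * (sqrt (x * ?X))\<^sup>2 + m\<^sup>2 * (sqrt (y * ?Y))\<^sup>2 + (l * m) * (2 * (sqrt (x * ?X) * sqrt (y * ?Y)))"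
    by algebra
  also have "\<dots> \<le> l\<^sup>2 * (x * ?X) + m\<^sup>2 * (y * ?Y) + (l * m) * (x * ?Y + y * ?X)"
    using assms mult_left_mono[OF amgm, of "l * m"] by simp
  also have "\<dots> = (l * x + m * y) * ((l + m) * N - (l * x + m * y))"
    by algebra
  finally show "(l * sqrt (x * ?X) + m * sqrt (y * ?Y))\<^sup>2
      \<le> (l * x + m * y) * (N - (l * x + m * y))"
    using assms by simp
qed

lemma phi_mono_towards_peak:
  assumes x: "0 \<le> x" "x \<le> real n + 1" and z: "z \<in> closed_segment x (phi_peak n)"
  shows "phi n x \<le> phi n z"
proof -
  define N where "N = real n + 1"
  let ?p = "phi_peak n"
  have "sqrt N \<le> N"
    using real_sqrt_le_mono[of N "N\<^sup>2"] by (simp add: N_def power2_eq_square)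
  hence p: "0 \<le> ?p" "?p \<le> N"
    by (auto simp: phi_peak_def N_def field_simps)
  obtain u where u: "0 \<le> u" "u \<le> 1" "z = (1 - u) * x + u * ?p"
    using z by (auto simp: closed_segment_def)
  have "phi n x = (1 - u) * phi n x + u * phi n x"
    by (simp add: algebra_simps)
  also have "\<dots> \<le> (1 - u) * phi n x + u * phi n ?p"
    using phi_le_phi_peak[OF x] u by (simp add: mult_left_mono)
  also have "\<dots> = 2 * sqrt n / N * ((1 - u) * sqrt (x * (N - x)) + u * sqrt (?p * (N - ?p)))
                   + (1 - 2 * z / N)"
    by (simp add: phi_def u(3) N_def add_divide_distrib diff_divide_distrib algebra_simps)
  also have "\<dots> \<le> 2 * sqrt n / N * sqrt (z * (N - z)) + (1 - 2 * z / N)"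
    unfolding u(3)
    by (intro add_mono mult_left_mono sqrt_parabola_concave)
      (use x p u in \<open>auto simp: N_def\<close>)
  also have "\<dots> = phi n z" by (simp add: phi_def N_def)
  finally show ?thesis .
qed

lemma psi_k_index: "psi n (k_index n) = max (psi n (a_index n)) (psi n (a_index n + 1))"
  by (simp add: k_index_def max_def add.commute)

lemma a_index_bounds:
  shows "real (a_index n) \<le> phi_peak n" "phi_peak n < real (a_index n) + 1"
proof -
  have "sqrt (real n + 1) \<le> real n + 1"
    using real_sqrt_le_mono[of "real n + 1" "(real n + 1)\<^sup>2"] by (simp add: power2_eq_square)
  hence "phi_peak n \<ge> 0" by (simp add: phi_peak_def)
  thus "real (a_index n) \<le> phi_peak n" "phi_peak n < real (a_index n) + 1"
    by (simp_all add: a_index_def flip: phi_peak_def)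
qed

text \<open>The peak lies between the consecutive integers \<open>a\<close> and \<open>a + 1\<close> among which \<open>k\<close> chooses, so each
  integer is separated from the peak by one of the two, or is one of the two.\<close>

lemma phi_le_psi_k_index:
  assumes "m \<le> n + 1"
  shows "phi n (real m) \<le> psi n (k_index n)"
proof (cases "m \<le> a_index n")
  case True
  hence "phi n m \<le> phi n (a_index n)"
    using assms a_index_bounds[of n]
    by (intro phi_mono_towards_peak) (auto simp: closed_segment_eq_real_ivl)
  thus ?thesis using phi_le_psi[of n "a_index n"] by (simp add: psi_k_index)
next
  case False
  hence "phi n m \<le> phi n (real (a_index n) + 1)"
    using assms a_index_bounds[of n]
    by (intro phi_mono_towards_peak) (auto simp: closed_segment_eq_real_ivl)
  thus ?thesis using phi_le_psi[of n "real (a_index n) + 1"] by (simp add: psi_k_index add.commute)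
qed

text \<open>The upper bound keeps \<open>k\<close> where \<open>psi\<close> and \<open>phi\<close> agree.  Only \<open>n = 2\<close>, with \<open>a = 0\<close> and \<open>k = 1\<close>, is too
  small for the estimates of the square root that settle all other cases.\<close>

lemma k_index_bounds:
  assumes "n \<ge> 2"
  shows "1 \<le> k_index n" "real (k_index n) \<le> (real n + 1) / 2"
proof -
  let ?r = "sqrt (real n + 1)"
  have r: "?r * ?r = real n + 1" by simp
  show "1 \<le> k_index n" 
  proof (cases "n = 2")
    case True
    have "a_index n = 0"
    proof (rule ccontr)
      assume "a_index n \<noteq> 0"
      hence "1 \<le> phi_peak n" using a_index_bounds(1)[of n] by linarith
      moreover have "1 < sqrt (3::real)" by simp
      ultimately show False by (simp add: phi_peak_def True)
    qed
    moreover have "psi n 0 \<le> psi n 1"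
    proof -
      have "psi n 0 = 1" by (simp add: psi_def)
      also have "\<dots> \<le> 2 * (sqrt 2 * sqrt 2) / 3 + 1 / 3" by simp
      also have "\<dots> = psi n 1" by (simp add: psi_def True)
      finally show ?thesis .
    qed
    ultimately show ?thesis by (simp add: k_index_def)
  next
    case False
    with assms have "2 \<le> ?r" by (intro real_le_rsqrt) simp
    hence "(?r - 1) * ?r \<ge> 1 * 2" by (intro mult_mono) auto
    hence "phi_peak n \<ge> 1" using r by (simp add: phi_peak_def algebra_simps)
    hence "a_index n \<ge> 1" using a_index_bounds(2)[of n] by linarith
    thus ?thesis by (simp add: k_index_def)
  qed
  show "real (k_index n) \<le> (real n + 1) / 2"
  proof -
    have le: "real (k_index n) \<le> real (a_index n) + 1" by (simp add: k_index_def)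
    show ?thesis
    proof (cases "n = 2")
      case True
      have "1 < sqrt (3::real)" by simp
      moreover have "phi_peak n = 3 / 2 - sqrt 3 / 2" by (simp add: phi_peak_def True)
      ultimately have "phi_peak n < 1" by linarith
      hence "real (a_index n) < 1" using a_index_bounds(1)[of n] by linarith
      thus ?thesis using le True by simp
    next
      case False
      with assms have "2 \<le> ?r" by (intro real_le_rsqrt) simp
      hence "phi_peak n \<le> (real n + 1) / 2 - 1" unfolding phi_peak_def by linarith
      thus ?thesis using le a_index_bounds(1)[of n] by linarith
    qed
  qed
qed

section \<open>Norms of interpolation projectors\<close>

lemma linear_polynomials_inner:
  fixes p :: "real ^ 'n \<Rightarrow> real"
  assumes "p \<in> linear_polynomials"
  shows "\<exists>c a. \<forall>x. p x = c + a \<bullet> x"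
proof -
  obtain c a where "\<And>x. p x = c + (\<Sum>i\<in>UNIV. a i * x $ i)"
    using assms by (auto simp: linear_polynomials_def)
  hence "p x = c + (\<chi> i. a i) \<bullet> x" for x
    by (simp add: inner_vec_def)
  thus ?thesis by blast
qed

lemma linear_polynomials_affine_combination:
  assumes "p \<in> linear_polynomials" "sum u S = 1"
  shows "p (\<Sum>v\<in>S. u v *\<^sub>R f v) = (\<Sum>v\<in>S. u v * p (f v))"
proof -
  obtain c a where p: "\<And>x. p x = c + a \<bullet> x"
    using linear_polynomials_inner[OF assms(1)] by blast
  have "(\<Sum>v\<in>S. u v * p (f v)) = sum u S * c + (\<Sum>v\<in>S. u v * (a \<bullet> f v))"
    by (simp only: p distrib_left sum.distrib sum_distrib_right)
  thus ?thesis by (simp add: p assms(2) inner_sum_right)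
qed

lemma linear_polynomials_line:
  assumes "p \<in> linear_polynomials"
  shows "p (g + t *\<^sub>R (h - g)) = (1 - t) * p g + t * p h"
proof -
  obtain c a where "\<And>x. p x = c + a \<bullet> x"
    using linear_polynomials_inner[OF assms] by blast
  thus ?thesis by (simp add: inner_add inner_diff algebra_simps)
qed

lemma linear_polynomials_centroid:
  assumes "p \<in> linear_polynomials" "finite M" "M \<noteq> {}" "\<And>x. x \<in> M \<Longrightarrow> p x = e"
  shows "p (centroid M) = e"
proof -
  have sum1: "(\<Sum>v\<in>M. 1 / real (card M)) = 1" using assms by simp
  have "p (centroid M) = (\<Sum>v\<in>M. 1 / real (card M) * p v)"
    using linear_polynomials_affine_combination[OF assms(1) sum1, of "\<lambda>v. v"]
    by (simp add: centroid_def scaleR_sum_right)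
  also have "\<dots> = (\<Sum>v\<in>M. 1 / real (card M) * e)"
    by (intro sum.cong) (simp_all add: assms(4))
  finally show ?thesis using assms by simp
qed

lemma abs_le_unif_norm:
  assumes "continuous_on unit_ball f" "x \<in> unit_ball"
  shows "\<bar>f x\<bar> \<le> unif_norm unit_ball f"
proof -
  have "compact ((\<lambda>x. \<bar>f x\<bar>) ` unit_ball)"
    using assms(1) by (intro compact_continuous_image continuous_intros) auto
  hence "bdd_above ((\<lambda>x. \<bar>f x\<bar>) ` unit_ball)"
    by (intro bounded_imp_bdd_above compact_imp_bounded)
  thus ?thesis
    unfolding unif_norm_def using assms(2) by (rule cSUP_upper[rotated])
qed

lemma unif_norm_le:
  assumes "\<And>x. x \<in> unit_ball \<Longrightarrow> \<bar>f x\<bar> \<le> b"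
  shows "unif_norm unit_ball f \<le> b"
  unfolding unif_norm_def
proof (rule cSUP_least)
  show "unit_ball \<noteq> {}" by simp
qed (rule assms)

lemma projector_formula:
  fixes A :: "real ^ 'n ^ 'n"
  assumes R: "regular_inscribed R" and A: "invertible A"
    and P: "interpolation_projector unit_ball (affine_map c A ` R) P" and f: "continuous_on unit_ball f"
  shows "P f (affine_map c A z) = (\<Sum>v\<in>R. bary v z * f (affine_map c A v))"
proof -
  have Pf: "P f \<in> linear_polynomials" "\<And>v. v \<in> R \<Longrightarrow> P f (affine_map c A v) = f (affine_map c A v)"
    using P f by (auto simp: interpolation_projector_def)
  have "affine_map c A z = (\<Sum>v\<in>R. bary v z *\<^sub>R affine_map c A v)"
    using affine_map_affine_combination[OF bary_reconstruction(1)[OF R], of c A z "\<lambda>v. v"]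
    by (simp add: bary_reconstruction(2)[OF R])
  also have "P f \<dots> = (\<Sum>v\<in>R. bary v z * P f (affine_map c A v))"
    by (rule linear_polynomials_affine_combination[OF Pf(1) bary_reconstruction(1)[OF R]])
  also have "\<dots> = (\<Sum>v\<in>R. bary v z * f (affine_map c A v))"
    by (intro sum.cong) (simp_all add: Pf(2))
  finally show ?thesis .
qed

lemma projector_abs_le:
  fixes A :: "real ^ 'n ^ 'n"
  assumes R: "regular_inscribed R" and A: "invertible A"
    and P: "interpolation_projector unit_ball (affine_map c A ` R) P"
    and f: "continuous_on unit_ball f" "unif_norm unit_ball f \<le> 1"
  shows "\<bar>P f (affine_map c A z)\<bar> \<le> (\<Sum>v\<in>R. \<bar>bary v z\<bar>)"
proof -
  have "\<bar>P f (affine_map c A z)\<bar> \<le> (\<Sum>v\<in>R. \<bar>bary v z * f (affine_map c A v)\<bar>)"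
    unfolding projector_formula[OF R A P f(1)] by (rule sum_abs)
  also have "\<dots> \<le> (\<Sum>v\<in>R. \<bar>bary v z\<bar>)"
  proof (rule sum_mono)
    fix v assume "v \<in> R"
    hence "affine_map c A v \<in> unit_ball"
      using P by (auto simp: interpolation_projector_def)
    hence "\<bar>f (affine_map c A v)\<bar> \<le> 1"
      using abs_le_unif_norm[OF f(1)] f(2) by force
    thus "\<bar>bary v z * f (affine_map c A v)\<bar> \<le> \<bar>bary v z\<bar>"
      by (simp add: abs_mult mult_left_le)
  qed
  finally show ?thesis .
qed

text \<open>A supremum bounds its members only if it is taken over a bounded set.  The bound on all \<open>P f\<close>
  comes from the sum of the absolute barycentric coordinates, a continuous function on the ball.\<close>

lemma abs_projector_le_operator_norm:
  fixes R X :: "(real ^ 'n) set"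
  assumes R: "regular_inscribed R" and P: "interpolation_projector unit_ball X P"
    and f: "continuous_on unit_ball f" "unif_norm unit_ball f \<le> 1" and y: "y \<in> unit_ball"
  shows "\<bar>P f y\<bar> \<le> operator_norm unit_ball P"
proof -
  obtain A c where A: "invertible A" and X: "X = affine_map c A ` R"
  proof -
    have "simplex_vertices X" using P by (simp add: interpolation_projector_def)
    thus thesis using simplex_affine_image_of_regular[OF R] that by blast
  qed
  define G where "G x = (\<Sum>v\<in>R. \<bar>bary v (matrix_inv A *v (x - c))\<bar>)" for x
  have "continuous_on unit_ball G"
    unfolding G_def bary_def
    by (intro continuous_intros bounded_linear.continuous_on[OF matrix_vector_mul_bounded_linear])
      (auto simp: add_nonneg_eq_0_iff)
  hence "\<bar>G x\<bar> \<le> unif_norm unit_ball G" if "x \<in> unit_ball" for x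
    using abs_le_unif_norm that by blast
  moreover have "\<bar>P g x\<bar> \<le> G x" if "continuous_on unit_ball g" "unif_norm unit_ball g \<le> 1" for g x
  proof -
    have "affine_map c A (matrix_inv A *v (x - c)) = x"
      by (rule iffD2[OF affine_map_inverse[OF A] refl])
    thus ?thesis
      using projector_abs_le[OF R A P[unfolded X] that, of "matrix_inv A *v (x - c)"]
      by (simp add: G_def)
  qed
  ultimately have bound: "\<bar>P g x\<bar> \<le> unif_norm unit_ball G"
    if "continuous_on unit_ball g" "unif_norm unit_ball g \<le> 1" "x \<in> unit_ball" for g x
    using that by (meson abs_ge_self order_trans)
  have "bdd_above ((\<lambda>x. \<bar>P f x\<bar>) ` unit_ball)"
    by (rule bdd_aboveI2[of _ _ "unif_norm unit_ball G"]) (rule bound[OF f])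
  hence "\<bar>P f y\<bar> \<le> unif_norm unit_ball (P f)"
    unfolding unif_norm_def using y by (rule cSUP_upper[rotated])
  also have "\<dots> \<le> operator_norm unit_ball P"
    unfolding operator_norm_def
  proof (rule cSUP_upper)
    show "bdd_above ((\<lambda>f. unif_norm unit_ball (P f)) `
        {f. continuous_on unit_ball f \<and> unif_norm unit_ball f \<le> 1})"
      by (rule bdd_aboveI2[of _ _ "unif_norm unit_ball G"]) (auto intro!: unif_norm_le bound)
  qed (use f in auto)
  finally show ?thesis .
qed

lemma operator_norm_le:
  assumes "\<And>f x. continuous_on unit_ball f \<Longrightarrow> unif_norm unit_ball f \<le> 1 \<Longrightarrow> x \<in> unit_ball \<Longrightarrow> \<bar>P f x\<bar> \<le> b"
  shows "operator_norm unit_ball P \<le> b"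
  unfolding operator_norm_def
proof (rule cSUP_least)
  have "unif_norm unit_ball (\<lambda>_. 0) \<le> 1"
    by (rule unif_norm_le) simp
  thus "{f. continuous_on unit_ball f \<and> unif_norm unit_ball f \<le> 1} \<noteq> {}"
    by (auto intro!: exI[of _ "\<lambda>_. 0"])
qed (use assms in \<open>auto intro!: unif_norm_le\<close>)

text \<open>Let \<open>m\<close> be the number of negative coordinates.  The sum of the absolute values is the inner
  product of the coordinates, whose mean is \<open>1 / (n + 1)\<close>, with their signs, whose mean is
  \<open>e = 1 - 2 * m / (n + 1)\<close>.  The Cauchy--Schwarz inequality for the two centered vectors gives the claim,
  since the sum of the squared coordinates is at most 1.\<close>

lemma sum_abs_bary_le_phi:
  fixes R :: "(real ^ 'n) set"
  assumes R: "regular_inscribed R" and z: "norm z \<le> 1"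
  shows "\<exists>m\<le>CARD('n) + 1. (\<Sum>v\<in>R. \<bar>bary v z\<bar>) \<le> phi CARD('n) (real m)"
proof -
  let ?n = "real CARD('n)"
  define N where "N = ?n + 1"
  have N: "N > 0" "?n = N - 1" by (simp_all add: N_def)
  have finR: "finite R" and cardR: "card R = CARD('n) + 1"
    using regular_inscribed_simplex[OF R] simplex_vertices_finite by (auto simp: simplex_vertices_def)
  hence rcard: "real (card R) = N" by (simp add: N_def)
  define K where "K = {v \<in> R. bary v z < 0}"
  define m where "m = card K"
  have K: "K \<subseteq> R" "m \<le> CARD('n) + 1"
    using card_mono[OF finR, of K] cardR by (auto simp: K_def m_def)
  define \<epsilon> :: "real ^ 'n \<Rightarrow> real" where "\<epsilon> v = (if v \<in> K then - 1 else 1)" for v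
  have \<epsilon>: "\<bar>bary v z\<bar> = bary v z * \<epsilon> v" if "v \<in> R" for v
    using that by (simp add: \<epsilon>_def K_def)
  define e where "e = 1 - 2 * real m / N"
  have sum_\<epsilon>: "(\<Sum>v\<in>R. \<epsilon> v) = N * e"
  proof -
    have "(\<Sum>v\<in>R. \<epsilon> v) = (\<Sum>v\<in>R. 1 - 2 * (if v \<in> K then 1 else 0))"
      by (intro sum.cong) (auto simp: \<epsilon>_def)
    also have "\<dots> = real (card R) - 2 * real (card (R \<inter> K))"
      using finR by (simp add: sum_subtractf flip: sum_distrib_left sum.inter_restrict)
    also have "R \<inter> K = K" using K by auto
    also have "real (card R) - 2 * real (card K) = N * e"
      using N(1) by (simp add: rcard e_def m_def right_diff_distrib)
    finally show ?thesis .
  qed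
  have "(\<Sum>v\<in>R. \<bar>bary v z\<bar>) - e = (\<Sum>v\<in>R. (bary v z - 1 / N) * (\<epsilon> v - e))"
  proof -
    have "(\<Sum>v\<in>R. (bary v z - 1 / N) * (\<epsilon> v - e)) =
        (\<Sum>v\<in>R. bary v z * \<epsilon> v - e * bary v z - 1 / N * \<epsilon> v + e / N)"
      by (intro sum.cong) (simp_all add: algebra_simps)
    also have "\<dots> = (\<Sum>v\<in>R. bary v z * \<epsilon> v) - e * (\<Sum>v\<in>R. bary v z) - 1 / N * (\<Sum>v\<in>R. \<epsilon> v) + real (card R) * (e / N)"
      by (simp only: sum.distrib sum_subtractf sum_distrib_left sum_constant)
    also have "\<dots> = (\<Sum>v\<in>R. bary v z * \<epsilon> v) - e"
      using N by (simp add: bary_reconstruction(1)[OF R] sum_\<epsilon> rcard)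
    finally show ?thesis using \<epsilon> by simp
  qed
  also have "\<dots> \<le> sqrt ((\<Sum>v\<in>R. (bary v z - 1 / N)\<^sup>2) * (\<Sum>v\<in>R. (\<epsilon> v - e)\<^sup>2))"
    by (rule real_le_rsqrt) (rule Cauchy_Schwarz_ineq_sum)
  also have "\<dots> \<le> sqrt (?n / N * (4 * (m * (N - m)) / N))"
  proof (intro real_sqrt_le_mono mult_mono)
    have "(\<Sum>v\<in>R. (bary v z - 1 / N)\<^sup>2) = (\<Sum>v\<in>R. (bary v z)\<^sup>2 - 2 / N * bary v z + (1 / N)\<^sup>2)"
      by (intro sum.cong) (simp_all add: power2_diff)
    also have "\<dots> = (\<Sum>v\<in>R. (bary v z)\<^sup>2) - 2 / N * (\<Sum>v\<in>R. bary v z) + real (card R) * (1 / N)\<^sup>2"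
      by (simp only: sum.distrib sum_subtractf sum_distrib_left sum_constant)
    also have "\<dots> = (1 + ?n * (norm z)\<^sup>2) / N - 1 / N"
      unfolding sum_bary_squares[OF R] bary_reconstruction(1)[OF R] rcard
      using N(1) by (simp add: power2_eq_square N_def add.commute)
    also have "\<dots> = ?n * (norm z)\<^sup>2 / N"
      by (simp add: add_divide_distrib)
    also have "\<dots> \<le> ?n / N"
      using N z by (intro divide_right_mono mult_left_le) (auto simp: power_le_one)
    finally show "(\<Sum>v\<in>R. (bary v z - 1 / N)\<^sup>2) \<le> ?n / N" .
    have "(\<Sum>v\<in>R. (\<epsilon> v - e)\<^sup>2) = (\<Sum>v\<in>R. 1 - 2 * e * \<epsilon> v + e\<^sup>2)"
      by (intro sum.cong) (auto simp: \<epsilon>_def power2_eq_square algebra_simps)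
    also have "\<dots> = N - 2 * e * (\<Sum>v\<in>R. \<epsilon> v) + N * e\<^sup>2"
      by (simp only: sum.distrib sum_subtractf sum_distrib_left sum_constant rcard mult_1_right)
    also have "\<dots> = 4 * (m * (N - m)) / N"
      using N(1) by (simp add: sum_\<epsilon> e_def power2_eq_square field_simps)
    finally show "(\<Sum>v\<in>R. (\<epsilon> v - e)\<^sup>2) \<le> 4 * (m * (N - m)) / N"
      by simp
  qed (use N in \<open>auto intro!: sum_nonneg\<close>)
  also have "\<dots> = 2 * sqrt ?n / N * sqrt (m * (N - m))"
  proof -
    have "?n / N * (4 * (m * (N - m)) / N) = (2 / N)\<^sup>2 * (?n * (m * (N - m)))"
      by (simp add: power2_eq_square)
    thus ?thesis using N(1) by (simp only: real_sqrt_mult real_sqrt_abs) simp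
  qed
  finally have "(\<Sum>v\<in>R. \<bar>bary v z\<bar>) \<le> phi CARD('n) m"
    by (simp add: phi_def e_def flip: N_def)
  thus ?thesis using K(2) by blast
qed

lemma operator_norm_regular_le:
  fixes R :: "(real ^ 'n) set"
  assumes R: "regular_inscribed R" and P: "interpolation_projector unit_ball R P"
  shows "operator_norm unit_ball P \<le> psi CARD('n) (k_index CARD('n))"
proof (rule operator_norm_le)
  fix f :: "real ^ 'n \<Rightarrow> real" and x :: "real ^ 'n"
  assume f: "continuous_on unit_ball f" "unif_norm unit_ball f \<le> 1" and x: "x \<in> unit_ball"
  have "interpolation_projector unit_ball (affine_map 0 (mat 1) ` R) P"
    using P by simp
  from projector_abs_le[OF R _ this f, of x]
  have "\<bar>P f x\<bar> \<le> (\<Sum>v\<in>R. \<bar>bary v x\<bar>)"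
    by (simp add: invertible_def)
  also obtain m where "m \<le> CARD('n) + 1" "(\<Sum>v\<in>R. \<bar>bary v x\<bar>) \<le> phi CARD('n) (real m)"
    using sum_abs_bary_le_phi[OF R, of x] x by auto
  hence "(\<Sum>v\<in>R. \<bar>bary v x\<bar>) \<le> psi CARD('n) (k_index CARD('n))"
    using phi_le_psi_k_index order_trans by blast
  finally show "\<bar>P f x\<bar> \<le> psi CARD('n) (k_index CARD('n))" .
qed

text \<open>The projector is tested on a continuous function of norm at most 1 that equals \<open>- 1\<close> on the
  vertices selected by the property and \<open>1\<close> on the others.  Its interpolant at the assigned point, which
  lies in the ball, has the value \<open>2 * t - 1\<close>.\<close>

lemma operator_norm_ge_if_property_H:
  fixes X :: "(real ^ 'n) set"
  assumes H: "property_H TYPE('n) m" and m: "1 \<le> m" "m \<le> CARD('n)"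
    and R: "regular_inscribed (R :: (real ^ 'n) set)"
    and P: "interpolation_projector unit_ball X P"
  shows "phi CARD('n) m \<le> operator_norm unit_ball P"
proof -
  have X: "simplex_vertices X" "X \<subseteq> unit_ball"
    using P by (auto simp: interpolation_projector_def)
  obtain A c where A: "invertible A" and XR: "X = affine_map c A ` R"
    using simplex_affine_image_of_regular[OF R X(1)] .
  let ?E = "affine_map c A ` cball 0 1"
  have "convex hull X \<subseteq> unit_ball"
    using X(2) by (simp add: hull_minimal)
  moreover have "minimal_ellipsoid (convex hull X) ?E"
    unfolding XR by (rule minimal_ellipsoid_of_affine_image[OF R A])
  ultimately obtain M y where M: "M \<subseteq> X" "card M = m" and y: "assigned_point X ?E M y" "y \<in> unit_ball"
    using H X(1) unfolding property_H_def by blast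
  obtain t where t: "y = centroid M + t *\<^sub>R (centroid (X - M) - centroid M)"
      "2 * t - 1 = phi CARD('n) m"
    using assigned_point_parameter[OF R A XR y(1) M m] unfolding phi_def by blast
  have finX: "finite X" and cardX: "card X = CARD('n) + 1"
    using X(1) simplex_vertices_finite by (auto simp: simplex_vertices_def)
  have "M \<noteq> {}" "X - M \<noteq> {}"
    using M m cardX card_mono[OF finite_subset[OF M(1) finX], of X] by auto
  define \<epsilon> :: "real ^ 'n \<Rightarrow> real" where "\<epsilon> x = (if x \<in> M then - 1 else 1)" for x
  have "continuous_on X \<epsilon>"
    using finX by (rule continuous_on_finite)
  moreover have "closedin (top_of_set unit_ball) X"
    using finX X(2) by (simp add: closed_subset finite_imp_closed)
  ultimately obtain f where f: "continuous_on unit_ball f" "\<And>x. x \<in> X \<Longrightarrow> f x = \<epsilon> x"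
      "\<And>x. x \<in> unit_ball \<Longrightarrow> f x \<in> cbox (- 1) 1"
    by (rule Tietze_closed_interval_1[where a = "- 1" and b = 1]) (auto simp: \<epsilon>_def)
  have Pf: "P f \<in> linear_polynomials" "\<And>x. x \<in> X \<Longrightarrow> P f x = \<epsilon> x"
    using P f(1,2) by (auto simp: interpolation_projector_def)
  have "P f (centroid M) = - 1"
  proof (rule linear_polynomials_centroid[OF Pf(1) finite_subset[OF M(1) finX] \<open>M \<noteq> {}\<close>])
    show "P f x = - 1" if "x \<in> M" for x
      using Pf(2)[of x] M(1) that by (auto simp: \<epsilon>_def)
  qed
  moreover have "P f (centroid (X - M)) = 1"
  proof (rule linear_polynomials_centroid[OF Pf(1) finite_Diff[OF finX] \<open>X - M \<noteq> {}\<close>])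
    show "P f x = 1" if "x \<in> X - M" for x
      using Pf(2)[of x] that by (auto simp: \<epsilon>_def)
  qed
  ultimately have "P f y = phi CARD('n) m"
    unfolding t(1) linear_polynomials_line[OF Pf(1)] by (simp flip: t(2))
  moreover have "\<bar>P f y\<bar> \<le> operator_norm unit_ball P"
    by (rule abs_projector_le_operator_norm[OF R P f(1) _ y(2)])
      (use f(3) in \<open>force intro!: unif_norm_le simp: abs_le_iff\<close>)
  ultimately show ?thesis by simp
qed

theorem theorem5:
  fixes X :: "(real ^ 'n) set"
    and P' :: "(real ^ 'n \<Rightarrow> real) \<Rightarrow> (real ^ 'n \<Rightarrow> real)"
  assumes "CARD('n) \<ge> 2"
    and "property_H TYPE('n) (k_index CARD('n))"
    and "regular_inscribed X"
    and "interpolation_projector unit_ball X P'"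
  shows "theta (unit_ball :: (real ^ 'n) set) = operator_norm unit_ball P'"
  unfolding theta_def
proof (rule cInf_eq_minimum)
  show "operator_norm unit_ball P' \<in>
      {operator_norm unit_ball P |P X. interpolation_projector unit_ball (X :: (real ^ 'n) set) P}"
    using assms(4) by blast
next
  fix r
  assume "r \<in> {operator_norm unit_ball P |P X. interpolation_projector unit_ball (X :: (real ^ 'n) set) P}"
  then obtain P and Y :: "(real ^ 'n) set"
    where P: "interpolation_projector unit_ball Y P" and r: "r = operator_norm unit_ball P"
    by blast
  let ?k = "k_index CARD('n)"
  note k = k_index_bounds[OF assms(1)]
  have "operator_norm unit_ball P' \<le> psi CARD('n) ?k"
    by (rule operator_norm_regular_le[OF assms(3,4)])
  also have "\<dots> = phi CARD('n) ?k"
    using k(2) by (rule psi_eq_phi)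
  also have "\<dots> \<le> r"
    unfolding r
  proof (rule operator_norm_ge_if_property_H[OF assms(2) k(1) _ assms(3) P])
    have "real ?k < CARD('n) + 1" using k(2) by simp
    thus "?k \<le> CARD('n)" by linarith
  qed
  finally show "operator_norm unit_ball P' \<le> r" .
qed

end
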